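(* Let $f,g\in\mathbb{Z}[x,y]$ have no common non-constant factor, let $R^{(y)}=\operatorname{res}(f,g;y)\in\mathbb{Z}[x]$ and $R^{(x)}=\operatorname{res}(f,g;x)\in\mathbb{Z}[y]$. Let $\alpha$ be a real root of $R^{(y)}$ and $\beta$ a real root of $R^{(x)}$, with associated discs $\Delta(\alpha),\Delta(\beta)\subset\mathbb{C}$, lower bounds $L(\alpha),L(\beta)$ and polydisc $\Delta(\alpha,\beta)=\Delta(\alpha)\times\Delta(\beta)\subset\mathbb{C}^2$ constructed as described in the context, and let $U(\alpha,\beta,u^{(y)})$, $U(\alpha,\beta,v^{(y)})$, $U(\alpha,\beta,u^{(x)})$, $U(\alpha,\beta,v^{(x)})$ be upper bounds as in the context. If there exists $(x_0,y_0)\in\Delta(\alpha,\beta)$ with $$U(\alpha,\beta,u^{(y)})\,|f(x_0,y_0)|+U(\alpha,\beta,v^{(y)})\,|g(x_0,y_0)|<L(\alpha)$$ and $$U(\alpha,\beta,u^{(x)})\,|f(x_0,y_0)|+U(\alpha,\beta,v^{(x)})\,|g(x_0,y_0)|<L(\beta),$$ then $\Delta(\alpha,\beta)$ contains a common complex zero of $f$ and $g$, and $f(\alpha,\beta)=0$.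
   Context: Notation: for an interval $I=(a,b)\subset\mathbb{R}$, $m_I=(a+b)/2$ and $r_I=(b-a)/2$; $\Delta_r(m)=\{z\in\mathbb{C}:|z-m|<r\}$. For $p\in\mathbb{R}[x]$ and reals $m,r,K$, the predicate $T^p_K(m,r)$ means $|p(m)|-K\sum_{k\ge1}\left|\frac{p^{(k)}(m)}{k!}\right|r^k>0$. Construction of $\Delta(\alpha)$ and $L(\alpha)$: write $R^{(y)}=\prod_{i=1}^{\deg R^{(y)}} r_i^{\,i}$ with $r_i\in\mathbb{Z}[x]$ square-free and pairwise coprime (square-free factorization). If $\alpha$ is a root of $r_{i_0}$, let $I=I(\alpha)$ be an open real interval containing $\alpha$ such that $T^{(r_{i_0})'}_{3/2}(m_I,8r_I)$ holds and $T^{r_i}_1(m_I,8r_I)$ holds for all $i\neq i_0$; set $\Delta(\alpha):=\Delta_{2r_I}(m_I)$ and $L(\alpha):=2^{-i_0-\deg R^{(y)}}|R^{(y)}(m_I-2r_I)|$. $\Delta(\beta)$ and $L(\beta)$ are constructed in exactly the same way from $R^{(x)}$ and its square-free factorization. Cofactors: let $m_y=\deg_y f$, $n_y=\deg_y g$ and let $S^{(y)}(f,g)$ be the $(m_y+n_y)\times(m_y+n_y)$ Sylvester matrix of $f,g$ regarded as polynomials in $y$ (entries in $\mathbb{Z}[x]$), whose determinant is $R^{(y)}$. Let $u^{(y)}$ (resp. $v^{(y)}$) be the determinant of the matrix obtained from $S^{(y)}(f,g)$ by replacing its last column by $(y^{n_y-1},\dots,y,1,0,\dots,0)^T$ (resp.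 $(0,\dots,0,y^{m_y-1},\dots,y,1)^T$); then $u^{(y)},v^{(y)}\in\mathbb{Z}[x,y]$ and $R^{(y)}=u^{(y)}f+v^{(y)}g$. The cofactors $u^{(x)},v^{(x)}$ with $R^{(x)}=u^{(x)}f+v^{(x)}g$ are defined analogously with the roles of $x$ and $y$ exchanged. The quantities $U(\alpha,\beta,u^{(y)})$ etc. are real numbers such that $|u^{(y)}(z_1,z_2)|\le U(\alpha,\beta,u^{(y)})$ for all $(z_1,z_2)$ in the closure of $\Delta(\alpha,\beta)$, and likewise for $v^{(y)},u^{(x)},v^{(x)}$. *)

theory Defs
  imports "Subresultants.Resultant_Prelim" "HOL-Analysis.Analysis"
    "HOL-Computational_Algebra.Polynomial_Factorial" "HOL-Computational_Algebra.Squarefree"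
begin

text \<open>Bivariate integer polynomials f in Z[x,y] are represented as int poly poly:
  polynomials in y whose coefficients are polynomials in x.\<close>

definition eval2 :: "int poly poly \<Rightarrow> complex \<Rightarrow> complex \<Rightarrow> complex" where
  "eval2 p a b = poly (map_poly (\<lambda>c. poly (map_poly of_int c) a) p) b"

definition swap_xy :: "int poly poly \<Rightarrow> int poly poly" where
  "swap_xy p = (\<Sum>i\<le>degree p. \<Sum>j\<le>degree (coeff p i). monom (monom (coeff (coeff p i) j) i) j)"

definition cof_u :: "int poly poly \<Rightarrow> int poly poly \<Rightarrow> int poly poly" where
  "cof_u f g = (let m = degree f; n = degree g; d = m + n in
     Determinant.det (Matrix.mat d d (\<lambda>(i,j). if j = d - 1 then (if i < n then monom 1 (n - 1 - i) else 0)
                           else [: sylvester_mat f g $$ (i,j) :])))"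

definition cof_v :: "int poly poly \<Rightarrow> int poly poly \<Rightarrow> int poly poly" where
  "cof_v f g = (let m = degree f; n = degree g; d = m + n in
     Determinant.det (Matrix.mat d d (\<lambda>(i,j). if j = d - 1 then (if i \<ge> n then monom 1 (d - 1 - i) else 0)
                           else [: sylvester_mat f g $$ (i,j) :])))"

text \<open>The predicate T^p_K(m,r); the sum over k \<ge> 1 is finite (terms vanish for k > degree p).\<close>
definition Tpred :: "real poly \<Rightarrow> real \<Rightarrow> real \<Rightarrow> real \<Rightarrow> bool" where
  "Tpred p K m r \<longleftrightarrow>
     \<bar>poly p m\<bar> - K * (\<Sum>k\<in>{1..degree p}. \<bar>poly ((pderiv ^^ k) p) m / fact k\<bar> * r ^ k) > 0"

definition rpoly :: "int poly \<Rightarrow> real poly" where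
  "rpoly p = map_poly real_of_int p"

definition iso_data :: "int poly \<Rightarrow> (nat \<Rightarrow> int poly) \<Rightarrow> nat \<Rightarrow> real \<Rightarrow> real \<Rightarrow> real \<Rightarrow> bool" where
  "iso_data R r i0 a b \<alpha> \<longleftrightarrow>
     R = (\<Prod>i\<in>{1..degree R}. r i ^ i) \<and>
     (\<forall>i\<in>{1..degree R}. squarefree (map_poly rat_of_int (r i))) \<and>
     (\<forall>i\<in>{1..degree R}. \<forall>j\<in>{1..degree R}. i \<noteq> j \<longrightarrow>
         coprime (map_poly rat_of_int (r i)) (map_poly rat_of_int (r j))) \<and>
     i0 \<in> {1..degree R} \<and> poly (rpoly (r i0)) \<alpha> = 0 \<and>
     a < b \<and> a < \<alpha> \<and> \<alpha> < b \<and>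
     Tpred (pderiv (rpoly (r i0))) (3/2) ((a+b)/2) (8 * ((b-a)/2)) \<and>
     (\<forall>i\<in>{1..degree R}. i \<noteq> i0 \<longrightarrow> Tpred (rpoly (r i)) 1 ((a+b)/2) (8 * ((b-a)/2)))"

definition disc :: "real \<Rightarrow> real \<Rightarrow> complex set" where
  "disc a b = ball (complex_of_real ((a+b)/2)) (2 * ((b-a)/2))"

definition cdisc :: "real \<Rightarrow> real \<Rightarrow> complex set" where
  "cdisc a b = cball (complex_of_real ((a+b)/2)) (2 * ((b-a)/2))"

definition Lbound :: "int poly \<Rightarrow> nat \<Rightarrow> real \<Rightarrow> real \<Rightarrow> real" where
  "Lbound R i0 a b = \<bar>poly (rpoly R) ((a+b)/2 - 2 * ((b-a)/2))\<bar> / 2 ^ (i0 + degree R)"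

end

theory Submission
  imports Defs "HOL-Complex_Analysis.Complex_Analysis"
begin

text \<open>
  By the cofactor identities and the conditions defining the two intervals, at every boundary point of
  the closed polydisc one of the weighted sums \<open>U \<bar>f\<bar> + V \<bar>g\<bar>\<close> is at least \<open>L\<close>. Assume that \<open>f\<close> and \<open>g\<close>
  have no common zero in the polydisc, and consider the algebraic curve on which \<open>(f, g)\<close> is
  proportional to its value \<open>(f0, g0) \<noteq> 0\<close> at \<open>(x0, y0)\<close>. The proportionality factor vanishes nowhere
  on the curve, so by the minimum modulus principle on this curve its modulus is at most \<open>1\<close> at some
  boundary point of the polydisc; there both \<open>\<bar>f\<bar>\<close> and \<open>\<bar>g\<bar>\<close> are no larger than at \<open>(x0, y0)\<close>, which
  contradicts the hypotheses. Finally, \<open>\<alpha>\<close> and \<open>\<beta>\<close> are the only roots of the two resultants in the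
  discs, hence \<open>(\<alpha>, \<beta>)\<close> is the common zero.
\<close>

section \<open>Minimum modulus on plane algebraic curves\<close>

text \<open>The outer variable is y and the coefficients lie in C[x]. Substituting the constant
  polynomial \<open>[:y:]\<close> first and evaluating at \<open>x\<close> afterwards makes this a
  composition of ring homomorphisms, from which the simp rules below follow.\<close>

definition bieval :: "complex poly poly \<Rightarrow> complex \<Rightarrow> complex \<Rightarrow> complex" where
  "bieval p x y = poly (poly p [:y:]) x"

lemma bieval_pCons [simp]: "bieval (pCons c p) x y = poly c x + y * bieval p x y"
  by (simp add: bieval_def)

lemma bieval_0 [simp]: "bieval 0 x y = 0"
  and bieval_1 [simp]: "bieval 1 x y = 1"
  and bieval_add [simp]: "bieval (p + q) x y = bieval p x y + bieval q x y"
  and bieval_diff [simp]: "bieval (p - q) x y = bieval p x y - bieval q x y"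
  and bieval_mult [simp]: "bieval (p * q) x y = bieval p x y * bieval q x y"
  and bieval_smult [simp]: "bieval (smult c p) x y = poly c x * bieval p x y"
  by (simp_all add: bieval_def)

lemma bieval_conv_poly: "bieval p x y = poly (map_poly (\<lambda>c. poly c x) p) y"
  by (induction p) (simp_all add: map_poly_pCons)

lemma continuous_on_bieval [continuous_intros]:
  assumes "continuous_on S f" "continuous_on S g"
  shows "continuous_on S (\<lambda>z. bieval p (f z) (g z))"
  by (induction p) (auto intro!: continuous_intros assms)

lemma has_field_derivative_bieval_fst:
  "((\<lambda>x. bieval p x y) has_field_derivative bieval (map_poly pderiv p) x y) (at x)"
proof (induction p)
  case (pCons c p)
  have "((\<lambda>x. poly c x + y * bieval p x y) has_field_derivative
      poly (pderiv c) x + y * bieval (map_poly pderiv p) x y) (at x)"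
    by (intro DERIV_add DERIV_cmult pCons.IH poly_DERIV)
  then show ?case
    by (simp add: Polynomial.map_poly_pCons)
qed simp

lemma has_field_derivative_bieval_snd:
  "((\<lambda>y. bieval p x y) has_field_derivative bieval (pderiv p) x y) (at y)"
proof (induction p)
  case (pCons c p)
  have "((\<lambda>y. poly c x + y * bieval p x y) has_field_derivative
      bieval p x y + y * bieval (pderiv p) x y) (at y)"
    by (rule derivative_eq_intros pCons.IH refl)+ simp
  moreover have "bieval (pCons c p) x = (\<lambda>y. poly c x + y * bieval p x y)"
    by (simp add: fun_eq_iff)
  ultimately show ?case
    by (simp add: pderiv_pCons)
qed simp

lemma deriv_bieval_snd: "deriv (bieval p x) y = bieval (pderiv p) x y"
  by (rule DERIV_imp_deriv) (rule has_field_derivative_bieval_snd)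

lemma holomorphic_on_bieval_snd: "bieval p x holomorphic_on S"
  using has_field_derivative_bieval_snd
  by (meson field_differentiable_at_within field_differentiable_def holomorphic_on_def)

lemma finite_zeros_bieval_snd:
  assumes "bieval p x y0 \<noteq> 0"
  shows "finite {y. bieval p x y = 0}"
proof -
  have "map_poly (\<lambda>c. poly c x) p \<noteq> 0"
    using assms by (auto simp: bieval_conv_poly)
  then show ?thesis
    by (simp add: bieval_conv_poly poly_roots_finite)
qed

section \<open>Zeros of a fibre \<open>h x\<close> counted by contour integrals\<close>

lemma holomorphic_on_contour_integral_circlepath:
  fixes F F' :: "complex \<Rightarrow> complex \<Rightarrow> complex"
  assumes U: "open U" "convex U" and r: "0 < r"
    and F: "continuous_on (U \<times> sphere z r) (\<lambda>(x, y). F x y)"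
    and F': "continuous_on (U \<times> sphere z r) (\<lambda>(x, y). F' x y)"
    and D: "\<And>x y. x \<in> U \<Longrightarrow> y \<in> sphere z r \<Longrightarrow> ((\<lambda>x. F x y) has_field_derivative F' x y) (at x)"
  shows "(\<lambda>x. contour_integral (circlepath z r) (F x)) holomorphic_on U"
proof -
  define \<gamma> where "\<gamma> = circlepath z r"
  \<comment> \<open>\<open>d\<close> is the derivative of the parametrisation
    \<open>\<gamma>\<close> of the circle. The contour integral becomes an integral over [0, 1], to
    which the Leibniz rule applies.\<close>
  define d where "d = (\<lambda>t. 2 * pi * \<i> * r * exp (2 * of_real pi * \<i> * of_real t) :: complex)"
  have \<gamma>: "\<gamma> t \<in> sphere z r" if "t \<in> {0..1}" for t
    using that r path_image_circlepath[of z r] by (auto simp: \<gamma>_def path_image_def)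
  have cont_\<gamma>: "continuous_on S \<gamma>" for S
    unfolding \<gamma>_def circlepath_def part_circlepath_def linepath_def by (intro continuous_intros)
  have cont_d: "continuous_on S d" for S
    unfolding d_def by (intro continuous_intros)
  have eq: "contour_integral (circlepath z r) (F x) = integral (cbox 0 1) (\<lambda>t. F x (\<gamma> t) * d t)" for x
    unfolding contour_integral_integral cbox_interval
    by (rule integral_cong) (simp add: vector_derivative_circlepath d_def \<gamma>_def mult_ac)
  show ?thesis
    unfolding eq
  proof (rule leibniz_rule_holomorphic)
    fix x and t :: real assume "x \<in> U" "t \<in> cbox 0 1"
    then show "((\<lambda>x. F x (\<gamma> t) * d t) has_field_derivative F' x (\<gamma> t) * d t) (at x within U)"
      by (intro DERIV_cmult_right has_field_derivative_at_within[OF D] \<gamma>) auto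
  next
    fix x assume x: "x \<in> U"
    have "continuous_on (cbox 0 1) (\<lambda>t. (\<lambda>(x, y). F x y) (x, \<gamma> t))"
      by (rule continuous_on_compose2[OF F]) (use x \<gamma> in \<open>auto intro!: continuous_intros cont_\<gamma>\<close>)
    then show "(\<lambda>t. F x (\<gamma> t) * d t) integrable_on cbox 0 1"
      by (intro integrable_continuous continuous_on_mult cont_d) auto
  next
    have "continuous_on (U \<times> cbox 0 1) (\<lambda>p. (\<lambda>(x, y). F' x y) (fst p, \<gamma> (snd p)))"
      by (rule continuous_on_compose2[OF F'])
        (use \<gamma> in \<open>auto intro!: continuous_intros continuous_on_compose2[OF cont_\<gamma>]\<close>)
    then show "continuous_on (U \<times> cbox 0 1) (\<lambda>(x, t). F' x (\<gamma> t) * d t)"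
      unfolding case_prod_beta
      by (intro continuous_on_mult continuous_on_compose2[OF cont_d continuous_on_snd]
          continuous_on_id) auto
  qed (rule U)
qed

text \<open>This is the argument principle with a weight \<open>\<omega>\<close> and without poles:
  the circle winds once around each zero inside it and not at all around those outside. The larger
  radius \<open>\<delta>\<close> provides an open set containing the closed disc.\<close>

lemma weighted_zero_count:
  assumes \<sigma>: "0 < \<sigma>" "\<sigma> < \<delta>"
    and \<omega>: "\<omega> holomorphic_on ball z \<delta>"
    and nz: "\<And>y. y \<in> sphere z \<sigma> \<Longrightarrow> bieval h x y \<noteq> 0"
  shows "contour_integral (circlepath z \<sigma>) (\<lambda>y. bieval (pderiv h) x y * \<omega> y / bieval h x y) =
      2 * pi * \<i> * (\<Sum>p\<in>{p \<in> ball z \<sigma>. bieval h x p = 0}. \<omega> p * of_int (zorder (bieval h x) p))"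
proof -
  \<comment> \<open>The argument principle is phrased for zeros and poles together; the set of poles
    is \<open>{}\<close> here.\<close>
  let ?pz = "{w \<in> ball z \<delta>. bieval h x w = 0 \<or> w \<in> {}}"
  obtain y0 where "y0 \<in> sphere z \<sigma>"
    using \<sigma> by (metis less_le_not_le sphere_eq_empty all_not_in_conv)
  then have fin: "finite {y. bieval h x y = 0}"
    using nz finite_zeros_bieval_snd by blast
  have fin': "finite ?pz"
    by (rule finite_subset[OF _ fin]) auto
  have "contour_integral (circlepath z \<sigma>) (\<lambda>y. deriv (bieval h x) y * \<omega> y / bieval h x y) =
      2 * pi * \<i> * (\<Sum>p\<in>?pz. winding_number (circlepath z \<sigma>) p * \<omega> p * zorder (bieval h x) p)"
  proof (rule argument_principle)
    show "path_image (circlepath z \<sigma>) \<subseteq> ball z \<delta> - ?pz"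
      using \<sigma> nz by (auto simp: path_image_circlepath)
    show "\<forall>w. w \<notin> ball z \<delta> \<longrightarrow> winding_number (circlepath z \<sigma>) w = 0"
    proof (intro allI impI)
      fix w assume "w \<notin> ball z \<delta>"
      then show "winding_number (circlepath z \<sigma>) w = 0"
        using \<sigma> by (intro winding_number_zero_outside[of _ "cball z \<sigma>"])
          (auto simp: path_image_circlepath)
    qed
  qed (use \<omega> fin' holomorphic_on_bieval_snd in auto)
  also have "(\<Sum>p\<in>?pz. winding_number (circlepath z \<sigma>) p * \<omega> p * zorder (bieval h x) p) =
      (\<Sum>p\<in>{p \<in> ball z \<sigma>. bieval h x p = 0}. \<omega> p * of_int (zorder (bieval h x) p))"
  proof (rule sum.mono_neutral_cong_right[OF fin'])
    show "\<forall>p\<in>?pz - {p \<in> ball z \<sigma>. bieval h x p = 0}.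
        winding_number (circlepath z \<sigma>) p * \<omega> p * zorder (bieval h x) p = 0"
    proof
      fix p assume p: "p \<in> ?pz - {p \<in> ball z \<sigma>. bieval h x p = 0}"
      then have "p \<notin> cball z \<sigma>"
        using nz[of p] by (auto simp: order.order_iff_strict)
      then have "winding_number (circlepath z \<sigma>) p = 0"
        using \<sigma> by (intro winding_number_zero_outside[of _ "cball z \<sigma>"])
          (auto simp: path_image_circlepath)
      then show "winding_number (circlepath z \<sigma>) p * \<omega> p * zorder (bieval h x) p = 0" by simp
    qed
  qed (use \<sigma> in \<open>auto simp: winding_number_circlepath dist_norm norm_minus_commute\<close>)
  finally show ?thesis
    by (simp add: deriv_bieval_snd)
qed


text \<open>The integrand is a quotient of polynomials with denominator \<open>k * h\<close>, which
  has no zero over the circle, so the quotient rule gives a continuous derivative in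
  \<open>x\<close>. With \<open>k = 1\<close> the integral counts zeros without weights.\<close>

lemma holomorphic_weighted_zero_count:
  assumes "0 < \<sigma>"
    and h: "\<And>x y. x \<in> ball x1 \<rho> \<Longrightarrow> y \<in> sphere z \<sigma> \<Longrightarrow> bieval h x y \<noteq> 0"
    and k: "\<And>x y. x \<in> ball x1 \<rho> \<Longrightarrow> y \<in> sphere z \<sigma> \<Longrightarrow> bieval k x y \<noteq> 0"
  shows "(\<lambda>x. contour_integral (circlepath z \<sigma>)
      (\<lambda>y. bieval (pderiv h) x y * (1 / bieval k x y) / bieval h x y)) holomorphic_on ball x1 \<rho>"
proof -
  let ?n = "pderiv h" and ?m = "k * h"
  let ?F = "\<lambda>x y. bieval ?n x y / bieval ?m x y"
  let ?F' = "\<lambda>x y. (bieval (map_poly pderiv ?n) x y * bieval ?m x y -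
      bieval ?n x y * bieval (map_poly pderiv ?m) x y) / (bieval ?m x y * bieval ?m x y)"
  have m: "bieval ?m x y \<noteq> 0" if "x \<in> ball x1 \<rho>" "y \<in> sphere z \<sigma>" for x y
    using h[OF that] k[OF that] by simp
  have "(\<lambda>x. contour_integral (circlepath z \<sigma>) (?F x)) holomorphic_on ball x1 \<rho>"
  proof (rule holomorphic_on_contour_integral_circlepath[where F' = ?F'])
    show "((\<lambda>x. ?F x y) has_field_derivative ?F' x y) (at x)"
      if "x \<in> ball x1 \<rho>" "y \<in> sphere z \<sigma>" for x y
      by (intro DERIV_divide has_field_derivative_bieval_fst m that)
  qed (use m assms(1) in \<open>auto simp: case_prod_beta simp del: bieval_mult intro!: continuous_intros\<close>)
  then show ?thesis
    by simp
qed

text \<open>The point \<open>y0\<close> excludes that \<open>h x\<close> vanishes identically, so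
  its zeros are isolated and have positive order. This makes the multiplicities in the sums over
  zeros positive.\<close>

lemma zorder_bieval_pos:
  assumes "bieval h x y0 \<noteq> 0" "bieval h x y = 0"
  shows "zorder (bieval h x) y > 0"
proof -
  have "frequently (\<lambda>w. bieval h x w \<noteq> 0) (at y)"
  proof -
    obtain e where "e > 0" "\<And>w. w \<in> ball y e \<Longrightarrow> w \<noteq> y \<Longrightarrow> bieval h x w \<noteq> 0"
      using finite_ball_avoid[of UNIV "{w. bieval h x w = 0}" y] finite_zeros_bieval_snd[OF assms(1)]
      by auto
    then have "eventually (\<lambda>w. bieval h x w \<noteq> 0) (at y)"
      unfolding eventually_at by (auto simp: dist_commute)
    then show ?thesis
      by (simp add: eventually_frequently)
  qed
  then show ?thesis
    using zorder_pos_iff[of "bieval h x" UNIV y] assms holomorphic_on_bieval_snd by auto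
qed

text \<open>The compact slice over \<open>x1\<close> and the closed zero set of \<open>h\<close> are
  disjoint, hence a positive distance apart; a lower bound for this distance serves as
  \<open>\<rho>\<close>.\<close>

lemma bieval_nz_neighbourhood:
  assumes "compact K" "\<And>y. y \<in> K \<Longrightarrow> bieval h x1 y \<noteq> 0"
  obtains \<rho> where "\<rho> > 0" "\<And>x y. x \<in> ball x1 \<rho> \<Longrightarrow> y \<in> K \<Longrightarrow> bieval h x y \<noteq> 0"
proof -
  let ?Z = "(\<lambda>p. bieval h (fst p) (snd p)) -` {0}"
  have "closed ?Z"
    by (intro continuous_closed_vimage) (auto intro!: continuous_on_interior[of UNIV] continuous_intros)
  moreover have "compact ({x1} \<times> K)"
    by (intro compact_Times assms) auto
  ultimately obtain \<rho> where \<rho>: "\<rho> > 0" "\<And>p q. p \<in> {x1} \<times> K \<Longrightarrow> q \<in> ?Z \<Longrightarrow> \<rho> \<le> dist p q"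
    using separate_compact_closed[of "{x1} \<times> K" ?Z] assms(2) by (auto simp: disjoint_iff)
  show thesis
  proof
    fix x y assume "x \<in> ball x1 \<rho>" "y \<in> K"
    then show "bieval h x y \<noteq> 0"
      using \<rho>(2)[of "(x1, y)" "(x, y)"] by (auto simp: dist_Pair_Pair)
  qed (rule \<rho>(1))
qed

text \<open>The holomorphic functions counting the zeros of \<open>h x\<close> near \<open>y1\<close> with weights \<open>1\<close> and \<open>1 / k\<close>
  have a constant quotient by the maximum modulus principle.\<close>

lemma curve_local_minimum:
  assumes h0: "bieval h x1 y1 = 0" and nz: "bieval h x1 y2 \<noteq> 0" and k0: "bieval k x1 y1 \<noteq> 0"
    and e: "e > 0"
    and min: "\<And>x y. \<lbrakk>x \<in> ball x1 e; y \<in> ball y1 e; bieval h x y = 0\<rbrakk> \<Longrightarrow>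
                cmod (bieval k x1 y1) \<le> cmod (bieval k x y)"
  shows "\<exists>\<rho>>0. \<forall>x\<in>ball x1 \<rho>. \<exists>y\<in>ball y1 e.
      bieval h x y = 0 \<and> cmod (bieval k x y) = cmod (bieval k x1 y1)"
proof -
  have "open ((\<lambda>y. bieval k x1 y) -` (- {0}))"
    by (intro open_vimage) (auto intro!: continuous_intros)
  then obtain \<delta>0 where \<delta>0: "\<delta>0 > 0" "\<And>y. y \<in> cball y1 \<delta>0 \<Longrightarrow> bieval k x1 y \<noteq> 0"
    using k0 unfolding open_contains_cball by (force simp: subset_iff)
  define \<delta> where "\<delta> = min \<delta>0 e"
  have \<delta>: "\<delta> > 0" "\<delta> \<le> e" and k\<delta>: "\<And>y. y \<in> cball y1 \<delta> \<Longrightarrow> bieval k x1 y \<noteq> 0"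
    using \<delta>0 e by (auto simp: \<delta>_def)
  obtain \<rho>1 where \<rho>1: "\<rho>1 > 0" "\<And>x y. x \<in> ball x1 \<rho>1 \<Longrightarrow> y \<in> cball y1 \<delta> \<Longrightarrow> bieval k x y \<noteq> 0"
    using bieval_nz_neighbourhood[OF compact_cball k\<delta>] by blast
  obtain \<sigma>0 where \<sigma>0: "\<sigma>0 > 0" "\<And>y. y \<in> ball y1 \<sigma>0 \<Longrightarrow> y \<noteq> y1 \<Longrightarrow> bieval h x1 y \<noteq> 0"
    using finite_ball_avoid[of UNIV "{y. bieval h x1 y = 0}" y1] finite_zeros_bieval_snd[OF nz] by auto
  \<comment> \<open>Within radius \<open>\<sigma>0\<close> the only zero of \<open>h x1\<close> is
    \<open>y1\<close>. Halving keeps the closed disc of radius \<open>\<sigma>\<close> inside that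
    disc and inside the disc on which \<open>k\<close> has no zero.\<close>
  define \<sigma> where "\<sigma> = min \<sigma>0 \<delta> / 2"
  have \<sigma>: "0 < \<sigma>" "\<sigma> < \<delta>" "\<sigma> < \<sigma>0"
    using \<sigma>0 \<delta> by (auto simp: \<sigma>_def)
  have "bieval h x1 y \<noteq> 0" if "y \<in> sphere y1 \<sigma>" for y
    using that \<sigma> by (intro \<sigma>0(2)) auto
  then obtain \<rho>2 where \<rho>2: "\<rho>2 > 0" "\<And>x y. x \<in> ball x1 \<rho>2 \<Longrightarrow> y \<in> sphere y1 \<sigma> \<Longrightarrow> bieval h x y \<noteq> 0"
    using bieval_nz_neighbourhood[OF compact_sphere] by blast
  define \<rho> where "\<rho> = min (min \<rho>1 \<rho>2) e"
  have \<rho>: "\<rho> > 0" "\<rho> \<le> e" and k\<rho>: "\<And>x y. x \<in> ball x1 \<rho> \<Longrightarrow> y \<in> cball y1 \<delta> \<Longrightarrow> bieval k x y \<noteq> 0"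
    and h\<rho>: "\<And>x y. x \<in> ball x1 \<rho> \<Longrightarrow> y \<in> sphere y1 \<sigma> \<Longrightarrow> bieval h x y \<noteq> 0"
    using \<rho>1 \<rho>2 e by (auto simp: \<rho>_def)
  define Z where "Z = (\<lambda>x. {p \<in> ball y1 \<sigma>. bieval h x p = 0})"
  define N where "N = (\<lambda>x p. real_of_int (zorder (bieval h x) p))"
  \<comment> \<open>Normalising by \<open>c\<close> gives \<open>y1\<close> the weight 1, so that
    \<open>S\<close> and \<open>m\<close> agree at \<open>x1\<close>; minimality of |c| on the curve
    bounds all weights \<open>c / bieval k x p\<close> by 1 in modulus.\<close>
  define c where "c = bieval k x1 y1"
  define m where "m = (\<lambda>x. \<Sum>p\<in>Z x. N x p)"
  define S where "S = (\<lambda>x. \<Sum>p\<in>Z x. c / bieval k x p * N x p)"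
  obtain y3 where y3: "y3 \<in> sphere y1 \<sigma>"
    using \<sigma> by (metis less_le_not_le sphere_eq_empty all_not_in_conv)
  have finZ: "finite (Z x)" if "x \<in> ball x1 \<rho>" for x
    using finite_zeros_bieval_snd[OF h\<rho>[OF that y3]] by (simp add: Z_def)
  have Npos: "N x p > 0" if "x \<in> ball x1 \<rho>" "p \<in> Z x" for x p
    using zorder_bieval_pos[OF h\<rho>[OF that(1) y3]] that(2) by (auto simp: N_def Z_def)
  have Zk: "bieval k x p \<noteq> 0" "norm (c / bieval k x p) \<le> 1" if "x \<in> ball x1 \<rho>" "p \<in> Z x" for x p
  proof -
    have p: "p \<in> ball y1 \<sigma>" "bieval h x p = 0"
      using that(2) by (auto simp: Z_def)
    then have "p \<in> cball y1 \<delta>" "p \<in> ball y1 e" "x \<in> ball x1 e"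
      using \<sigma> \<delta> \<rho> that(1) by auto
    then show "bieval k x p \<noteq> 0"  "norm (c / bieval k x p) \<le> 1"
      using k\<rho> that(1) min p by (auto simp: c_def norm_divide divide_simps)
  qed
  have mhol: "(\<lambda>x. of_real (m x)) holomorphic_on ball x1 \<rho>"
  proof -
    let ?I = "\<lambda>x. contour_integral (circlepath y1 \<sigma>)
      (\<lambda>y. bieval (pderiv h) x y * (1 / bieval 1 x y) / bieval h x y)"
    have "(\<lambda>x. ?I x / (2 * pi * \<i>)) holomorphic_on ball x1 \<rho>"
      by (intro holomorphic_intros holomorphic_weighted_zero_count \<sigma> h\<rho>) auto
    moreover have "?I x / (2 * pi * \<i>) = of_real (m x)" if "x \<in> ball x1 \<rho>" for x
      using weighted_zero_count[OF \<sigma>(1,2), of "\<lambda>y. 1 / bieval 1 x y" y1 h x] h\<rho>[OF that]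
      by (auto simp: m_def Z_def N_def intro!: holomorphic_intros)
    ultimately show ?thesis
      by (rule holomorphic_transform)
  qed
  have Shol: "S holomorphic_on ball x1 \<rho>"
  proof -
    let ?I = "\<lambda>x. contour_integral (circlepath y1 \<sigma>)
      (\<lambda>y. bieval (pderiv h) x y * (1 / bieval k x y) / bieval h x y)"
    have "(\<lambda>x. c * (?I x / (2 * pi * \<i>))) holomorphic_on ball x1 \<rho>"
      using \<sigma> by (intro holomorphic_intros holomorphic_weighted_zero_count \<sigma> h\<rho> k\<rho>) auto
    moreover have "c * (?I x / (2 * pi * \<i>)) = S x" if "x \<in> ball x1 \<rho>" for x
    proof -
      have "(\<lambda>y. 1 / bieval k x y) holomorphic_on ball y1 \<delta>"
        using k\<rho>[OF that] by (intro holomorphic_intros holomorphic_on_bieval_snd) auto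
      moreover have "S x = c * (\<Sum>p\<in>Z x. 1 / bieval k x p * N x p)"
        by (simp add: S_def sum_distrib_left)
      ultimately show ?thesis
        using weighted_zero_count[OF \<sigma>(1,2), of "\<lambda>y. 1 / bieval k x y" y1 h x] h\<rho>[OF that]
        by (simp add: Z_def N_def)
    qed
    ultimately show ?thesis
      by (rule holomorphic_transform)
  qed
  have x1: "x1 \<in> ball x1 \<rho>" using \<rho> by simp
  have Z1: "Z x1 = {y1}"
    using \<sigma>0(2) \<sigma> h0 by (force simp: Z_def)
  have m1: "m x1 > 0"
    using Npos[OF x1] Z1 by (simp add: m_def)
  have S1: "S x1 = of_real (m x1)"
    using k0 by (simp add: S_def m_def Z1 c_def)
  \<comment> \<open>A continuous integer-valued function on a connected set is constant, since
    distinct values are at least 1 apart.\<close>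
  have mconst: "m x = m x1" if "x \<in> ball x1 \<rho>" for x
  proof -
    have "(\<lambda>x. of_real (m x) :: complex) constant_on ball x1 \<rho>"
    proof (rule continuous_discrete_range_constant)
      show "continuous_on (ball x1 \<rho>) (\<lambda>x. of_real (m x) :: complex)"
        using mhol by (rule holomorphic_on_imp_continuous_on)
      have mint: "m x \<in> \<int>" for x
        by (auto simp: m_def N_def)
      show "\<exists>e>0. \<forall>y. y \<in> ball x1 \<rho> \<and> complex_of_real (m y) \<noteq> of_real (m x) \<longrightarrow>
          e \<le> cmod (of_real (m y) - of_real (m x))" for x
      proof (intro exI[of _ 1] conjI allI impI)
        fix y assume "y \<in> ball x1 \<rho> \<and> complex_of_real (m y) \<noteq> of_real (m x)"
        then have "m y - m x \<noteq> 0" "m y - m x \<in> \<int>" using mint by auto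
        then have "1 \<le> \<bar>m y - m x\<bar>" by (metis Ints_nonzero_abs_ge1)
        then show "1 \<le> cmod (of_real (m y) - of_real (m x))"
          by (metis norm_of_real of_real_diff)
      qed simp
    qed auto
    then show ?thesis
      using that x1 unfolding constant_on_def by (metis of_real_eq_iff)
  qed
  \<comment> \<open>Here |S x| \<le> m x = m x1 = |S x1|, so |S| attains its maximum at the centre
    of the ball.\<close>
  have "S constant_on ball x1 \<rho>"
  proof (rule maximum_modulus_principle[OF Shol _ _ open_ball order_refl x1])
    fix x assume x: "x \<in> ball x1 \<rho>"
    have "norm (S x) \<le> (\<Sum>p\<in>Z x. norm (c / bieval k x p * N x p))"
      unfolding S_def by (rule norm_sum)
    also have "\<dots> \<le> (\<Sum>p\<in>Z x. 1 * N x p)"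
    proof (rule sum_mono)
      fix p assume p: "p \<in> Z x"
      show "norm (c / bieval k x p * N x p) \<le> 1 * N x p"
        using Zk(2)[OF x p] Npos[OF x p] unfolding norm_mult norm_of_real
        by (intro mult_mono) auto
    qed
    also have "\<dots> = norm (S x1)"
      using mconst[OF x] m1 by (simp add: S1) (simp add: m_def)
    finally show "norm (S x) \<le> norm (S x1)" .
  qed auto
  then have Sconst: "S x = of_real (m x)" if "x \<in> ball x1 \<rho>" for x
    using that x1 S1 mconst[OF that] unfolding constant_on_def by metis
  show ?thesis
  proof (intro exI[of _ \<rho>] conjI ballI)
    fix x assume x: "x \<in> ball x1 \<rho>"
    \<comment> \<open>The number of zeros is constant and positive, so no fibre over the ball is
      empty.\<close>
    have "Z x \<noteq> {}"
      using mconst[OF x] m1 by (auto simp: m_def)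
    then obtain p where p: "p \<in> Z x" by blast
    \<comment> \<open>This is the equality case of the triangle inequality: the real parts of the
      weights are at most 1 and their weighted sum reaches \<open>m x\<close>, so each real part is
      1, and with modulus at most 1 each weight has modulus exactly 1.\<close>
    have "(\<Sum>p\<in>Z x. (1 - Re (c / bieval k x p)) * N x p) = m x - Re (S x)"
      by (simp add: S_def m_def sum_subtractf left_diff_distrib del: times_divide_eq_left)
    also have "\<dots> = 0"
      using Sconst[OF x] by simp
    finally have sum0: "(\<Sum>p\<in>Z x. (1 - Re (c / bieval k x p)) * N x p) = 0" .
    have nonneg: "0 \<le> (1 - Re (c / bieval k x p)) * N x p" if "p \<in> Z x" for p
      using Zk(2)[OF x that] Npos[OF x that] complex_Re_le_cmod[of "c / bieval k x p"]
      by (intro mult_nonneg_nonneg) auto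
    have "\<forall>p\<in>Z x. (1 - Re (c / bieval k x p)) * N x p = 0"
      using sum0 nonneg by (subst (asm) sum_nonneg_eq_0_iff[OF finZ[OF x]])
    then have "(1 - Re (c / bieval k x p)) * N x p = 0"
      using p by (rule bspec)
    then have "Re (c / bieval k x p) = 1"
      using Npos[OF x p] by simp
    then have "norm (c / bieval k x p) = 1"
      using Zk(2)[OF x p] complex_Re_le_cmod[of "c / bieval k x p"] by linarith
    then have "cmod (bieval k x p) = cmod c"
      using Zk(1)[OF x p] by (simp add: norm_divide field_simps)
    then show "\<exists>y\<in>ball y1 e. bieval h x y = 0 \<and> cmod (bieval k x y) = cmod (bieval k x1 y1)"
      using p \<sigma> \<delta> by (intro bexI[of _ p]) (auto simp: Z_def c_def)
  qed (rule \<rho>)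
qed

text \<open>Among all minimisers of \<open>\<bar>k\<bar>\<close> on the curve, one of maximal real part in the first coordinate
  cannot be interior, unless the curve contains the vertical line through it.\<close>

lemma curve_minimum_principle:
  assumes x0: "x0 \<in> cball m1 r1" and y0: "y0 \<in> cball m2 r2" and h0: "bieval h x0 y0 = 0"
    and knz: "\<And>x y. \<lbrakk>x \<in> cball m1 r1; y \<in> cball m2 r2; bieval h x y = 0\<rbrakk> \<Longrightarrow> bieval k x y \<noteq> 0"
  obtains x y where "x \<in> cball m1 r1" "y \<in> cball m2 r2" "x \<in> sphere m1 r1 \<or> y \<in> sphere m2 r2"
    "bieval h x y = 0" "cmod (bieval k x y) \<le> cmod (bieval k x0 y0)"
proof -
  define V where "V = (cball m1 r1 \<times> cball m2 r2) \<inter> (\<lambda>p. bieval h (fst p) (snd p)) -` {0}"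
  have V: "compact V"
    unfolding V_def
    by (intro compact_Int_closed compact_Times compact_cball continuous_closed_vimage)
      (auto intro!: continuous_on_interior[of UNIV] continuous_intros)
  have "(x0, y0) \<in> V"
    using x0 y0 h0 by (simp add: V_def)
  moreover have cont: "continuous_on A (\<lambda>p. cmod (bieval k (fst p) (snd p)))" for A
    by (intro continuous_intros)
  ultimately obtain q where q: "q \<in> V"
    "\<And>p. p \<in> V \<Longrightarrow> cmod (bieval k (fst q) (snd q)) \<le> cmod (bieval k (fst p) (snd p))"
    using continuous_attains_inf[OF V _ cont] by blast
  define M where "M = cmod (bieval k (fst q) (snd q))"
  define K where "K = V \<inter> (\<lambda>p. cmod (bieval k (fst p) (snd p))) -` {M}"
  have K: "compact K"
    unfolding K_def
    by (intro compact_Int_closed V continuous_closed_vimage)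
      (auto intro!: continuous_on_interior[of UNIV] continuous_intros)
  have "q \<in> K"
    using q by (simp add: K_def M_def)
  moreover have "continuous_on K (\<lambda>p. Re (fst p))"
    by (intro continuous_intros)
  ultimately obtain p where p: "p \<in> K" "\<And>p'. p' \<in> K \<Longrightarrow> Re (fst p') \<le> Re (fst p)"
    using continuous_attains_sup[OF K] by blast
  obtain x1 y1 where [simp]: "p = (x1, y1)" by (cases p)
  have p1: "x1 \<in> cball m1 r1" "y1 \<in> cball m2 r2" "bieval h x1 y1 = 0" "cmod (bieval k x1 y1) = M"
    using p(1) by (auto simp: K_def V_def)
  have M: "M \<le> cmod (bieval k x y)" if "x \<in> cball m1 r1" "y \<in> cball m2 r2" "bieval h x y = 0" for x y
    using q(2)[of "(x, y)"] that by (simp add: V_def M_def)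
  have M0: "M \<le> cmod (bieval k x0 y0)"
    by (rule M[OF x0 y0 h0])
  \<comment> \<open>In the second case the curve contains the whole vertical line over
    \<open>x1\<close>; in the third the zeros of \<open>h x1\<close> are isolated and the local
    statement applies.\<close>
  consider "x1 \<in> sphere m1 r1 \<or> y1 \<in> sphere m2 r2"
    | "x1 \<in> ball m1 r1" "y1 \<in> ball m2 r2" "\<And>y. bieval h x1 y = 0"
    | y2 where "x1 \<in> ball m1 r1" "y1 \<in> ball m2 r2" "bieval h x1 y2 \<noteq> 0"
    using p1 by (force simp: order.order_iff_strict)
  then show thesis
  proof cases
    case 1
    then show thesis
      using that p1 M0 by metis
  next
    case 2
    have nz: "bieval k x1 y \<noteq> 0" if "y \<in> cball m2 r2" for y
      using knz[OF p1(1) that] 2 by blast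
    have "\<exists>y\<in>sphere m2 r2. cmod (bieval k x1 y) \<le> M"
    proof (rule ccontr)
      assume "\<not> ?thesis"
      then have less: "\<And>y. y \<in> sphere m2 r2 \<Longrightarrow> M < cmod (bieval k x1 y)" by force
      have "r2 > 0"
        using 2(2) by (metis ball_empty empty_iff not_le)
      have Mpos: "M > 0"
        using p1 nz[OF p1(2)] by auto
      have "sphere m2 r2 \<noteq> {}" "continuous_on (sphere m2 r2) (\<lambda>y. cmod (bieval k x1 y))"
        using \<open>r2 > 0\<close> by (auto intro!: continuous_intros simp: sphere_eq_empty)
      then obtain y' where y': "y' \<in> sphere m2 r2"
        "\<And>y. y \<in> sphere m2 r2 \<Longrightarrow> cmod (bieval k x1 y') \<le> cmod (bieval k x1 y)"
        using continuous_attains_inf[of "sphere m2 r2" "\<lambda>y. cmod (bieval k x1 y)"] by auto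
      have "cmod (1 / bieval k x1 y1) \<le> 1 / cmod (bieval k x1 y')"
      proof (rule maximum_modulus_frontier
            [where f = "\<lambda>y. 1 / bieval k x1 y" and S = "cball m2 r2" and \<xi> = y1])
        show "(\<lambda>y. 1 / bieval k x1 y) holomorphic_on interior (cball m2 r2)"
          using nz by (intro holomorphic_intros holomorphic_on_bieval_snd) auto
        show "continuous_on (closure (cball m2 r2)) (\<lambda>y. 1 / bieval k x1 y)"
          using nz by (auto intro!: continuous_intros)
        fix y assume "y \<in> frontier (cball m2 r2)"
        then show "cmod (1 / bieval k x1 y) \<le> 1 / cmod (bieval k x1 y')"
          using y'(2)[of y] less[OF y'(1)] Mpos
          by (auto simp: norm_divide frontier_cball intro!: divide_left_mono mult_pos_pos)
      qed (use p1 in auto)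
      then have "1 / M \<le> 1 / cmod (bieval k x1 y')"
        by (simp add: norm_divide p1)
      then show False
        using less[OF y'(1)] Mpos frac_less2[of 1 1 M "cmod (bieval k x1 y')"] by simp
    qed
    then obtain y where "y \<in> sphere m2 r2" "cmod (bieval k x1 y) \<le> M" by blast
    then show thesis
      using that[OF p1(1), of y] 2 M0 by auto
  next
    case (3 y2)
    obtain e1 where e1: "e1 > 0" "ball x1 e1 \<subseteq> ball m1 r1"
      using 3(1) by (meson open_ball openE)
    obtain e2 where e2: "e2 > 0" "ball y1 e2 \<subseteq> ball m2 r2"
      using 3(2) by (meson open_ball openE)
    define e where "e = min e1 e2"
    have e: "e > 0" "ball x1 e \<subseteq> cball m1 r1" "ball y1 e \<subseteq> cball m2 r2"
      using e1 e2 subset_ball[of e e1 x1] subset_ball[of e e2 y1] ball_subset_cball[of m1 r1]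
        ball_subset_cball[of m2 r2] by (auto simp: e_def)
    have min: "cmod (bieval k x1 y1) \<le> cmod (bieval k x y)"
      if "x \<in> ball x1 e" "y \<in> ball y1 e" "bieval h x y = 0" for x y
      unfolding p1(4) using that by (intro M subsetD[OF e(2)] subsetD[OF e(3)])
    obtain \<rho> where \<rho>: "\<rho> > 0" "\<forall>x\<in>ball x1 \<rho>. \<exists>y\<in>ball y1 e.
        bieval h x y = 0 \<and> cmod (bieval k x y) = cmod (bieval k x1 y1)"
      using curve_local_minimum[of h x1 y1 y2 k e, OF p1(3) 3(3) knz[OF p1(1-3)] e(1) min] by blast
    \<comment> \<open>A small step to the right of \<open>x1\<close> still meets the curve at a
      minimiser, which contradicts the maximal real part of \<open>x1\<close>.\<close>
    define t where "t = min \<rho> e / 2"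
    have t: "0 < t" "t < \<rho>" "t < e"
      using \<rho>(1) e(1) by (auto simp: t_def)
    define x where "x = x1 + of_real t"
    have x: "x \<in> ball x1 \<rho>" "x \<in> ball x1 e" "Re x > Re x1"
      using t by (simp_all add: x_def dist_norm)
    obtain y where "y \<in> ball y1 e" "bieval h x y = 0" "cmod (bieval k x y) = M"
      using bspec[OF \<rho>(2) x(1)] unfolding p1(4) by blast
    then have "(x, y) \<in> K"
      using subsetD[OF e(2) x(2)] subsetD[OF e(3)] by (simp add: K_def V_def)
    from p(2)[OF this] show thesis
      using x(3) by simp
  qed
qed

section \<open>Resultants and cofactors\<close>

lemma eval2_pCons [simp]: "eval2 (pCons c p) a b = poly (map_poly of_int c) a + b * eval2 p a b"
  by (simp add: eval2_def Polynomial.map_poly_pCons)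

lemma eval2_0 [simp]: "eval2 0 a b = 0"
  by (simp add: eval2_def)

lemma eval2_add: "eval2 (p + q) a b = eval2 p a b + eval2 q a b"
proof (induction p arbitrary: q)
  case (pCons c p)
  obtain c' q' where "q = pCons c' q'"
    by (rule pCons_cases)
  then show ?case
    by (simp add: pCons.IH of_int_poly_hom.hom_add algebra_simps)
qed simp

lemma eval2_smult: "eval2 (smult c p) a b = poly (map_poly of_int c) a * eval2 p a b"
  by (induction p) (simp_all add: of_int_poly_hom.hom_mult algebra_simps)

lemma eval2_mult: "eval2 (p * q) a b = eval2 p a b * eval2 q a b"
  by (induction p) (simp_all add: eval2_add eval2_smult algebra_simps)

lemma eval2_sum: "eval2 (sum f A) a b = (\<Sum>i\<in>A. eval2 (f i) a b)"
  by (induction A rule: infinite_finite_induct) (simp_all add: eval2_add)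

lemma eval2_monom: "eval2 (monom c n) a b = poly (map_poly of_int c) a * b ^ n"
  by (induction n) (simp_all add: monom_Suc monom_0 algebra_simps)

text \<open>Both sides expand to the same double sum of monomials. This lets the resultant with
  respect to x be treated as that of the swapped polynomials.\<close>

lemma eval2_swap_xy: "eval2 (swap_xy p) b a = eval2 p a b"
proof -
  have of_int_monom: "map_poly of_int (monom k n) = (monom (of_int k) n :: complex poly)" for k n
    by (simp add: map_poly_monom)
  have *: "poly (map_poly of_int c) z = (\<Sum>j\<le>degree c. of_int (coeff c j) * z ^ j)" for c and z :: complex
    by (subst (1) poly_as_sum_of_monoms[of c, symmetric])
       (simp add: of_int_poly_hom.hom_sum of_int_monom poly_sum poly_monom)
  have "eval2 p a b = eval2 (\<Sum>i\<le>degree p. monom (coeff p i) i) a b"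
    by (simp add: poly_as_sum_of_monoms)
  also have "\<dots> = (\<Sum>i\<le>degree p. \<Sum>j\<le>degree (coeff p i). of_int (coeff (coeff p i) j) * b ^ i * a ^ j)"
    by (simp add: eval2_sum eval2_monom * sum_distrib_left sum_distrib_right mult_ac)
  also have "\<dots> = eval2 (swap_xy p) b a"
    by (simp add: swap_xy_def eval2_sum eval2_monom of_int_monom poly_monom)
  finally show ?thesis ..
qed

section \<open>The cofactor identity for the Sylvester matrix\<close>

lemma det_replace_col:
  assumes "A \<in> carrier_mat n n" "k < n"
  shows "Determinant.det (replace_col A b k) = (\<Sum>i<n. vec_index b i * cofactor A i k)"
proof -
  have "replace_col A b k \<in> carrier_mat n n"
    using assms by (auto simp: replace_col_def)
  \<comment> \<open>The minors along column \<open>k\<close> delete the replaced column, so they are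
    those of \<open>A\<close>.\<close>
  from laplace_expansion_column[OF this assms(2)] show ?thesis
    using assms by (auto intro!: sum.cong arg_cong[of _ _ Determinant.det] arg_cong[of _ _ "\<lambda>x. _ * x"]
        simp: replace_col_def cofactor_def mat_delete_def)
qed

text \<open>The Sylvester matrix maps the column \<open>w\<close> of descending powers of y to the
  column of shifts of \<open>f\<close> and \<open>g\<close>, which is \<open>bu\<close> times
  \<open>f\<close> plus \<open>bv\<close> times \<open>g\<close>. Cramer's rule for the last column,
  where \<open>w\<close> has the entry 1, and linearity of the determinant in that column give the
  identity.\<close>

lemma resultant_cofactors:
  assumes d: "degree f + degree g > 0"
  shows "[:resultant f g:] = cof_u f g * f + cof_v f g * g"
proof -
  let ?m = "degree f" and ?n = "degree g"
  let ?d = "?m + ?n"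
  define A where "A = map_mat (\<lambda>c. [:c:]) (sylvester_mat f g)"
  define w where "w = Matrix.vec ?d (\<lambda>j. monom (1 :: int poly) (?d - 1 - j))"
  define bu where "bu = Matrix.vec ?d (\<lambda>i. if i < ?n then monom (1 :: int poly) (?n - 1 - i) else 0)"
  define bv where "bv = Matrix.vec ?d (\<lambda>i. if i \<ge> ?n then monom (1 :: int poly) (?d - 1 - i) else 0)"
  have A: "A \<in> carrier_mat ?d ?d"
    by (rule carrier_matI) (simp_all add: A_def)
  have detA: "Determinant.det A = [:resultant f g:]"
  proof -
    interpret comm_ring_hom "\<lambda>c :: int poly. [:c:]"
      by unfold_locales auto
    show ?thesis
      by (simp add: A_def resultant_def)
  qed
  have "cof_u f g = Determinant.det (replace_col A bu (?d - 1))"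
    unfolding cof_u_def Let_def
    by (rule arg_cong[of _ _ Determinant.det]) (auto simp: replace_col_def A_def bu_def)
  also have "\<dots> = (\<Sum>i<?d. vec_index bu i * cofactor A i (?d - 1))"
    by (rule det_replace_col[OF A]) (use d in simp)
  finally have u: "cof_u f g = (\<Sum>i<?d. vec_index bu i * cofactor A i (?d - 1))" .
  have "cof_v f g = Determinant.det (replace_col A bv (?d - 1))"
    unfolding cof_v_def Let_def
    by (rule arg_cong[of _ _ Determinant.det]) (auto simp: replace_col_def A_def bv_def)
  also have "\<dots> = (\<Sum>i<?d. vec_index bv i * cofactor A i (?d - 1))"
    by (rule det_replace_col[OF A]) (use d in simp)
  finally have v: "cof_v f g = (\<Sum>i<?d. vec_index bv i * cofactor A i (?d - 1))" .
  have expand: "(\<Sum>j<?d. [:coeff p (?d - 1 - j):] * monom 1 (?d - 1 - j)) = p"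
    if "degree p < ?d" for p :: "int poly poly"
  proof -
    have "(\<Sum>j<?d. [:coeff p (?d - 1 - j):] * monom 1 (?d - 1 - j)) = (\<Sum>j<?d. monom (coeff p (?d - 1 - j)) (?d - 1 - j))"
      by (simp add: smult_monom)
    also have "\<dots> = (\<Sum>j<?d. monom (coeff p j) j)"
      by (subst sum.nat_diff_reindex[symmetric]) simp
    also have "\<dots> = (\<Sum>j\<le>?d - 1. monom (coeff p j) j)"
      using d by (intro sum.cong) auto
    also have "\<dots> = p"
      using that by (intro poly_as_sum_of_monoms') auto
    finally show ?thesis .
  qed
  have Aw: "vec_index (A *\<^sub>v w) i = vec_index bu i * f + vec_index bv i * g" if i: "i < ?d" for i
  proof -
    \<comment> \<open>Row \<open>i\<close> of the Sylvester matrix lists the coefficients of this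
      shifted polynomial in descending order; its degree is below \<open>?d\<close>, so none is
      lost.\<close>
    define p where "p = (if i < ?n then monom 1 (?n - 1 - i) * f else monom 1 (?d - 1 - i) * g)"
    have deg: "degree p < ?d"
    proof (cases "i < ?n")
      case True
      have "degree p \<le> (?n - 1 - i) + ?m"
        using True degree_mult_le[of "monom 1 (?n - 1 - i)" f] degree_monom_le[of "1 :: int poly" "?n - 1 - i"]
        by (simp add: p_def)
      then show ?thesis using True by linarith
    next
      case False
      have "degree p \<le> (?d - 1 - i) + ?n"
        using False degree_mult_le[of "monom 1 (?d - 1 - i)" g] degree_monom_le[of "1 :: int poly" "?d - 1 - i"]
        by (simp add: p_def)
      then show ?thesis using False i by linarith
    qed
    have S: "sylvester_mat f g $$ (i, j) = coeff p (?d - 1 - j)" if "j < ?d" for j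
      using that i by (auto simp: sylvester_index_mat p_def coeff_monom_mult coeff_eq_0)
    have "vec_index (A *\<^sub>v w) i = (\<Sum>j<?d. [:sylvester_mat f g $$ (i, j):] * monom 1 (?d - 1 - j))"
      using i by (simp add: A_def w_def scalar_prod_def atLeast0LessThan)
    also have "\<dots> = p"
      using expand[OF deg] by (simp add: S)
    also have "p = vec_index bu i * f + vec_index bv i * g"
      using i by (simp add: p_def bu_def bv_def)
    finally show ?thesis .
  qed
  have "[:resultant f g:] = vec_index w (?d - 1) * Determinant.det A"
    using d by (simp add: w_def detA)
  also have "\<dots> = Determinant.det (replace_col A (A *\<^sub>v w) (?d - 1))"
    by (rule cramer_lemma_mat[OF A, symmetric]) (use d in \<open>auto simp: w_def\<close>)
  also have "\<dots> = (\<Sum>i<?d. vec_index (A *\<^sub>v w) i * cofactor A i (?d - 1))"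
    by (rule det_replace_col[OF A]) (use d in simp)
  also have "\<dots> = cof_u f g * f + cof_v f g * g"
    by (simp add: Aw u v sum_distrib_left sum.distrib algebra_simps)
  finally show ?thesis .
qed

lemma eval2_resultant:
  assumes "degree (resultant f g) > 0"
  shows "poly (map_poly of_int (resultant f g)) a =
      eval2 (cof_u f g) a b * eval2 f a b + eval2 (cof_v f g) a b * eval2 g a b"
proof -
  \<comment> \<open>If both degrees in y were 0, the resultant would be 1, against its positive
    degree; the cofactor identity needs a last column to replace.\<close>
  have "degree f + degree g > 0"
  proof (rule ccontr)
    assume "\<not> ?thesis"
    then obtain c where "f = [:c:]" "degree g = 0"
      by (metis add_is_0 degree_eq_zeroE gr0I)
    then show False using assms by simp
  qed
  from arg_cong[OF resultant_cofactors[OF this], of "\<lambda>p. eval2 p a b"] show ?thesis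
    by (simp add: eval2_add eval2_mult)
qed

section \<open>Lower bounds on the boundary of the isolating discs\<close>

lemma poly_taylor_complex:
  fixes p :: "complex poly"
  shows "poly p z = (\<Sum>k\<le>degree p. poly ((pderiv ^^ k) p) m / fact k * (z - m) ^ k)"
proof -
  have deriv: "(deriv ^^ k) (poly p) = poly ((pderiv ^^ k) p)" for k
  proof (induction k)
    case (Suc k)
    have "deriv (poly q) = poly (pderiv q)" for q :: "complex poly"
      by (auto simp: fun_eq_iff intro!: DERIV_imp_deriv poly_DERIV)
    then show ?case
      by (simp add: Suc)
  qed simp
  \<comment> \<open>Any disc about \<open>m\<close> that contains \<open>z\<close> would do. The
    power series on it breaks off at the degree.\<close>
  have "poly p holomorphic_on ball m (dist m z + 1)"
    by (intro holomorphic_intros)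
  then have "(\<lambda>k. poly ((pderiv ^^ k) p) m / fact k * (z - m) ^ k) sums poly p z"
    using holomorphic_power_series[of "poly p" m "dist m z + 1" z] by (simp add: deriv)
  moreover have "(\<lambda>k. poly ((pderiv ^^ k) p) m / fact k * (z - m) ^ k) sums
      (\<Sum>k\<le>degree p. poly ((pderiv ^^ k) p) m / fact k * (z - m) ^ k)"
  proof (rule sums_finite)
    fix k assume "k \<notin> {..degree p}"
    then have "(pderiv ^^ k) p = 0"
      by (intro poly_eqI) (simp add: coeff_higher_pderiv coeff_eq_0)
    then show "poly ((pderiv ^^ k) p) m / fact k * (z - m) ^ k = 0" by simp
  qed simp
  ultimately show ?thesis
    by (rule sums_unique2)
qed

lemma poly_of_real_of_real:
  "poly (map_poly complex_of_real p) (of_real x) = of_real (poly p x)"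
  by (induction p) (simp_all add: Polynomial.map_poly_pCons)

text \<open>At a quarter of the radius every Taylor term with k at least 1 shrinks by a factor of at
  least 4, while \<open>Tpred\<close> bounds the sum of the unshrunk terms by |p(m)|/K. For the
  radius 8r in the isolation conditions this covers the disc of radius 2r.\<close>

lemma Tpred_poly_close:
  assumes T: "Tpred p K m \<rho>" and "K > 0" "\<rho> \<ge> 0" and z: "cmod (z - of_real m) \<le> \<rho> / 4"
  shows "cmod (poly (map_poly of_real p) z - of_real (poly p m)) < \<bar>poly p m\<bar> / (4 * K)"
proof -
  let ?P = "map_poly complex_of_real p"
  let ?c = "\<lambda>k. poly ((pderiv ^^ k) p) m / fact k"
  have c: "poly ((pderiv ^^ k) ?P) (of_real m) / fact k = of_real (?c k)" for k
    by (simp add: of_real_hom.map_poly_higher_pderiv[symmetric] poly_of_real_of_real)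
  have "poly ?P z = (\<Sum>k\<le>degree p. of_real (?c k) * (z - of_real m) ^ k)"
    using poly_taylor_complex[of ?P z "of_real m"] unfolding c by (simp add: degree_map_poly)
  also have "\<dots> = of_real (poly p m) + (\<Sum>k=1..degree p. of_real (?c k) * (z - of_real m) ^ k)"
    by (simp add: atMost_atLeast0 sum.atLeast_Suc_atMost)
  finally have "cmod (poly ?P z - of_real (poly p m)) =
      cmod (\<Sum>k=1..degree p. of_real (?c k) * (z - of_real m) ^ k)"
    by simp
  also have "\<dots> \<le> (\<Sum>k=1..degree p. \<bar>?c k\<bar> * \<rho> ^ k / 4)"
  proof (rule sum_norm_le)
    fix k assume k: "k \<in> {1..degree p}"
    have "cmod (z - of_real m) ^ k \<le> (\<rho> / 4) ^ k"
      by (rule power_mono[OF z]) simp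
    also have "\<dots> = \<rho> ^ k * (1 / 4) ^ k"
      by (simp add: power_divide)
    also have "\<dots> \<le> \<rho> ^ k * (1 / 4) ^ 1"
      using k \<open>\<rho> \<ge> 0\<close> by (intro mult_left_mono power_decreasing) auto
    finally have "\<bar>?c k\<bar> * cmod (z - of_real m) ^ k \<le> \<bar>?c k\<bar> * (\<rho> ^ k * (1 / 4) ^ 1)"
      by (rule mult_left_mono) simp
    then show "cmod (of_real (?c k) * (z - of_real m) ^ k) \<le> \<bar>?c k\<bar> * \<rho> ^ k / 4"
      unfolding norm_mult norm_of_real norm_power by simp
  qed
  also have "\<dots> = (\<Sum>k=1..degree p. \<bar>?c k\<bar> * \<rho> ^ k) / 4"
    by (rule sum_divide_distrib[symmetric])
  also have "\<dots> < \<bar>poly p m\<bar> / (4 * K)"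
    using T \<open>K > 0\<close> by (simp add: Tpred_def field_simps)
  finally show ?thesis .
qed

text \<open>On the disc |p| lies between 3/4 and 5/4 of |p(m)|, so two values differ by a factor
  below 2. A constant \<open>p\<close> is treated apart, because the claimed factor is then
  1.\<close>

lemma Tpred_1_growth:
  assumes T: "Tpred p 1 m (8 * \<rho>)" and "\<rho> \<ge> 0"
    and z: "cmod (z - of_real m) \<le> 2 * \<rho>" and w: "cmod (w - of_real m) \<le> 2 * \<rho>"
  shows "poly (map_poly of_real p) z \<noteq> 0"
    and "cmod (poly (map_poly of_real p) w) \<le> 2 ^ degree p * cmod (poly (map_poly of_real p) z)"
proof -
  let ?P = "map_poly complex_of_real p"
  define c where "c = complex_of_real (poly p m)"
  have z': "cmod (poly ?P z - c) < cmod c / 4" and w': "cmod (poly ?P w - c) < cmod c / 4"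
    using Tpred_poly_close[OF T] assms by (simp_all add: c_def)
  have lower: "cmod (poly ?P z) > 3 / 4 * cmod c"
    using z' norm_triangle_ineq2[of c "poly ?P z"] by (simp add: norm_minus_commute)
  then show "poly ?P z \<noteq> 0"
    using z' by auto
  show "cmod (poly ?P w) \<le> 2 ^ degree p * cmod (poly ?P z)"
  proof (cases "degree p = 0")
    case True
    then show ?thesis
      by (auto simp: Polynomial.map_poly_pCons elim!: degree_eq_zeroE)
  next
    case False
    have "cmod (poly ?P w) \<le> 5 / 4 * cmod c"
      using w' norm_triangle_ineq2[of "poly ?P w" c] by simp
    also have "\<dots> \<le> 2 ^ 1 * cmod (poly ?P z)"
      unfolding power_one_right using lower norm_ge_zero[of c] by linarith
    also have "\<dots> \<le> 2 ^ degree p * cmod (poly ?P z)"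
      using False by (intro mult_right_mono power_increasing) auto
    finally show ?thesis .
  qed
qed

text \<open>With K = 3/2 the derivative stays within |p'(m)|/6 of p'(m), and the mean value
  inequality for p(z) - p'(m) z between \<open>z\<close> and the root \<open>\<alpha>\<close> gives
  the bound.\<close>

lemma Tpred_pderiv_linear:
  assumes T: "Tpred (pderiv p) (3 / 2) m (8 * \<rho>)" and root: "poly p \<alpha> = 0" and \<alpha>: "\<bar>\<alpha> - m\<bar> \<le> 2 * \<rho>"
    and z: "cmod (z - of_real m) \<le> 2 * \<rho>"
  shows "cmod (poly (map_poly of_real p) z - of_real (poly (pderiv p) m) * (z - of_real \<alpha>))
           \<le> \<bar>poly (pderiv p) m\<bar> / 6 * cmod (z - of_real \<alpha>)"
proof -
  let ?P = "map_poly complex_of_real p" and ?c = "poly (pderiv p) m"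
  let ?G = "\<lambda>z. poly ?P z - of_real ?c * z"
  have "cmod (?G z - ?G (of_real \<alpha>)) \<le> \<bar>?c\<bar> / 6 * cmod (z - of_real \<alpha>)"
  proof (rule field_differentiable_bound[OF convex_cball])
    fix w assume w: "w \<in> cball (complex_of_real m) (2 * \<rho>)"
    show "(?G has_field_derivative poly (pderiv ?P) w - of_real ?c) (at w within cball (of_real m) (2 * \<rho>))"
      by (rule derivative_eq_intros poly_DERIV[THEN has_field_derivative_at_within] refl)+ simp
    have "cmod (poly (map_poly of_real (pderiv p)) w - of_real ?c) < \<bar>?c\<bar> / (4 * (3 / 2))"
      by (rule Tpred_poly_close[OF T]) (use w \<alpha> in \<open>auto simp: dist_norm norm_minus_commute\<close>)
    then show "cmod (poly (pderiv ?P) w - of_real ?c) \<le> \<bar>?c\<bar> / 6"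
      by (simp add: of_real_hom.map_poly_pderiv)
  next
    have "cmod (of_real m - of_real \<alpha>) = \<bar>\<alpha> - m\<bar>"
      by (metis norm_of_real of_real_diff abs_minus_commute)
    then show "of_real \<alpha> \<in> cball (complex_of_real m) (2 * \<rho>)"
      using \<alpha> by (simp add: dist_norm)
  qed (use z in \<open>auto simp: dist_norm norm_minus_commute\<close>)
  then show ?thesis
    by (simp add: poly_of_real_of_real root algebra_simps)
qed

text \<open>On the disc |p(z)| lies between 5/6 and 7/6 of |p'(m)| |z - \<alpha>|, with p'(m)
  nonzero; so \<open>\<alpha>\<close> is the only zero. Distances to \<open>\<alpha>\<close> are at
  least \<open>\<rho>\<close> on the circle and at most \<open>3 * \<rho>\<close> in the disc, so
  values grow by at most 3 * 7/5 = 21/5.\<close>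

lemma Tpred_pderiv_growth:
  assumes T: "Tpred (pderiv p) (3 / 2) m (8 * \<rho>)" and root: "poly p \<alpha> = 0" and \<alpha>: "\<bar>\<alpha> - m\<bar> < \<rho>"
  shows "\<lbrakk>cmod (z - of_real m) \<le> 2 * \<rho>; poly (map_poly of_real p) z = 0\<rbrakk> \<Longrightarrow> z = of_real \<alpha>"
    and "\<lbrakk>cmod (z - of_real m) = 2 * \<rho>; cmod (w - of_real m) \<le> 2 * \<rho>\<rbrakk> \<Longrightarrow>
      cmod (poly (map_poly of_real p) w) \<le> 2 ^ (degree p + 1) * cmod (poly (map_poly of_real p) z)"
proof -
  let ?P = "map_poly complex_of_real p"
  define c where "c = poly (pderiv p) m"
  have "\<rho> > 0" using \<alpha> by linarith
  have "c \<noteq> 0"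
    using T sum_nonneg[of "{1..degree (pderiv p)}" "\<lambda>k. \<bar>poly ((pderiv ^^ k) (pderiv p)) m / fact k\<bar> * (8 * \<rho>) ^ k"]
      \<open>\<rho> > 0\<close> by (auto simp: Tpred_def c_def)
  have \<alpha>': "\<bar>\<alpha> - m\<bar> \<le> 2 * \<rho>"
    using \<alpha> \<open>\<rho> > 0\<close> by linarith
  have lin: "cmod (poly ?P z - of_real c * (z - of_real \<alpha>)) \<le> \<bar>c\<bar> / 6 * cmod (z - of_real \<alpha>)"
    if "cmod (z - of_real m) \<le> 2 * \<rho>" for z
    unfolding c_def by (rule Tpred_pderiv_linear[OF T root \<alpha>' that])
  have upper: "cmod (poly ?P z) \<le> 7 / 6 * (\<bar>c\<bar> * cmod (z - of_real \<alpha>))"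
    and lower: "5 / 6 * (\<bar>c\<bar> * cmod (z - of_real \<alpha>)) \<le> cmod (poly ?P z)"
    if "cmod (z - of_real m) \<le> 2 * \<rho>" for z
    using lin[OF that] norm_triangle_ineq2[of "poly ?P z" "of_real c * (z - of_real \<alpha>)"]
      norm_triangle_ineq3[of "poly ?P z" "of_real c * (z - of_real \<alpha>)"]
    by (simp_all add: norm_mult)
  show "z = of_real \<alpha>" if "cmod (z - of_real m) \<le> 2 * \<rho>" "poly ?P z = 0"
  proof -
    have "\<bar>c\<bar> * cmod (z - of_real \<alpha>) \<le> 0"
      using lower[OF that(1)] that(2) by simp
    then show ?thesis
      using \<open>c \<noteq> 0\<close> by (simp add: mult_le_0_iff)
  qed
  show "cmod (poly ?P w) \<le> 2 ^ (degree p + 1) * cmod (poly ?P z)"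
    if z: "cmod (z - of_real m) = 2 * \<rho>" and w: "cmod (w - of_real m) \<le> 2 * \<rho>"
  proof -
    have \<alpha>m: "cmod (of_real \<alpha> - of_real m) = \<bar>\<alpha> - m\<bar>"
      by (metis norm_of_real of_real_diff)
    have "cmod (z - of_real \<alpha>) \<ge> \<rho>"
      using norm_triangle_ineq2[of "z - of_real m" "of_real \<alpha> - of_real m"] z \<alpha> \<alpha>m by simp
    moreover have "cmod (w - of_real \<alpha>) \<le> 3 * \<rho>"
      using norm_triangle_ineq4[of "w - of_real m" "of_real \<alpha> - of_real m"] w \<alpha> \<alpha>m by simp
    ultimately have ratio: "\<bar>c\<bar> * cmod (w - of_real \<alpha>) \<le> 3 * (\<bar>c\<bar> * cmod (z - of_real \<alpha>))"
      using mult_left_mono[of "cmod (w - of_real \<alpha>)" "3 * cmod (z - of_real \<alpha>)" "\<bar>c\<bar>"] by simp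
    have "degree p \<noteq> 0"
      using \<open>c \<noteq> 0\<close> by (metis c_def pderiv_eq_0_iff poly_0)
    show ?thesis
    \<comment> \<open>For degree 1 the allowed factor is only 4 < 21/5, but then p is exactly linear
      and the factor is 3; from degree 2 on the allowed factor is at least 8.\<close>
    proof (cases "degree p = 1")
      case True
      then obtain a0 a1 where "p = [:a0, a1:]"
        by (metis One_nat_def degree_eq_zeroE degree_pCons_eq_if nat.inject pCons_cases zero_neq_one)
      then have "poly ?P u = of_real c * (u - of_real \<alpha>)" for u
        using root by (simp add: c_def pderiv_pCons Polynomial.map_poly_pCons algebra_simps)
          (metis add.commute add_eq_0_iff2 of_real_minus of_real_mult)
      then have eq: "cmod (poly ?P u) = \<bar>c\<bar> * cmod (u - of_real \<alpha>)" for u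
        by (simp add: norm_mult)
      have "cmod (poly ?P w) \<le> 3 * cmod (poly ?P z)"
        using ratio unfolding eq .
      then show ?thesis
        using True norm_ge_zero[of "poly ?P z"] by (simp del: norm_ge_zero)
    next
      case False
      have "cmod (poly ?P w) \<le> 21 / 5 * cmod (poly ?P z)"
        using upper[OF w] lower[of z] ratio z by simp
      also have "\<dots> \<le> 2 ^ 3 * cmod (poly ?P z)"
        by (intro mult_right_mono) auto
      also have "\<dots> \<le> 2 ^ (degree p + 1) * cmod (poly ?P z)"
        using False \<open>degree p \<noteq> 0\<close> by (intro mult_right_mono power_increasing) auto
      finally show ?thesis .
    qed
  qed
qed

section \<open>The resultant on an isolating disc, through its square-free factors\<close>

lemma of_real_rpoly: "map_poly complex_of_real (rpoly p) = map_poly of_int p"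
  by (simp add: rpoly_def map_poly_map_poly o_def)

lemma degree_rpoly [simp]: "degree (rpoly p) = degree p"
  by (simp add: rpoly_def degree_map_poly)

lemma iso_data_degree_pos:
  assumes "iso_data R r i0 a b \<alpha>"
  shows "degree R > 0"
  using assms by (auto simp: iso_data_def)

lemma poly_squarefree_product:
  assumes "R = (\<Prod>i\<in>I. r i ^ i)"
  shows "poly (map_poly of_int R) z = (\<Prod>i\<in>I. poly (map_poly complex_of_real (rpoly (r i))) z ^ i)"
  unfolding assms of_real_rpoly
  by (simp add: of_int_poly_hom.hom_prod of_int_poly_hom.hom_power poly_prod)

text \<open>A root of \<open>R\<close> is a root of some factor \<open>r i\<close>. The factors with
  \<open>i \<noteq> i0\<close> have no root in the closed disc, and \<open>r i0\<close> has only
  \<open>\<alpha>\<close>.\<close>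

lemma iso_data_unique_root:
  assumes iso: "iso_data R r i0 a b \<alpha>"
    and z: "z \<in> cdisc a b" and 0: "poly (map_poly of_int R) z = 0"
  shows "z = of_real \<alpha>"
proof -
  let ?m = "(a + b) / 2" and ?\<rho> = "(b - a) / 2"
  have R: "R = (\<Prod>i\<in>{1..degree R}. r i ^ i)" and ab: "a < \<alpha>" "\<alpha> < b"
    and root: "poly (rpoly (r i0)) \<alpha> = 0"
    and T0: "Tpred (pderiv (rpoly (r i0))) (3/2) ?m (8 * ?\<rho>)"
    and T: "\<And>i. i \<in> {1..degree R} \<Longrightarrow> i \<noteq> i0 \<Longrightarrow> Tpred (rpoly (r i)) 1 ?m (8 * ?\<rho>)"
    using iso unfolding iso_data_def by blast+
  have z': "cmod (z - of_real ?m) \<le> 2 * ?\<rho>"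
    using z by (simp add: cdisc_def dist_norm norm_minus_commute)
  obtain i where i: "i \<in> {1..degree R}" "poly (map_poly of_real (rpoly (r i))) z = 0"
    using 0 unfolding poly_squarefree_product[OF R] by (auto simp: prod_zero_iff)
  have "i = i0"
    using Tpred_1_growth(1)[OF T[OF i(1)] _ z' z'] i(2) ab by auto
  moreover have "\<bar>\<alpha> - ?m\<bar> < ?\<rho>"
    using ab by (simp add: abs_less_iff field_simps)
  ultimately show ?thesis
    using Tpred_pderiv_growth(1)[OF T0 root _ z'] i(2) by simp
qed

text \<open>\<open>Lbound\<close> uses the value of \<open>R\<close> at the leftmost point
  \<open>w\<close> of the circle. Each factor at \<open>w\<close> is compared with the same factor
  at \<open>z\<close>, and the powers of 2 so lost multiply to the denominator of
  \<open>Lbound\<close>.\<close>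

lemma Lbound_le_boundary:
  assumes iso: "iso_data R r i0 a b \<alpha>"
    and z: "z \<in> sphere (of_real ((a + b) / 2)) (2 * ((b - a) / 2))"
  shows "Lbound R i0 a b \<le> cmod (poly (map_poly of_int R) z)"
proof -
  let ?m = "(a + b) / 2" and ?\<rho> = "(b - a) / 2"
  let ?I = "{1..degree R}"
  let ?P = "\<lambda>i. poly (map_poly complex_of_real (rpoly (r i)))"
  define w where "w = complex_of_real (?m - 2 * ?\<rho>)"
  have R: "R = (\<Prod>i\<in>?I. r i ^ i)" and i0: "i0 \<in> ?I" and ab: "a < \<alpha>" "\<alpha> < b"
    and root: "poly (rpoly (r i0)) \<alpha> = 0"
    and T0: "Tpred (pderiv (rpoly (r i0))) (3/2) ?m (8 * ?\<rho>)"
    and T: "\<And>i. i \<in> ?I \<Longrightarrow> i \<noteq> i0 \<Longrightarrow> Tpred (rpoly (r i)) 1 ?m (8 * ?\<rho>)"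
    using iso unfolding iso_data_def by blast+
  have z': "cmod (z - of_real ?m) = 2 * ?\<rho>"
    using z by (simp add: dist_norm norm_minus_commute)
  have "w - of_real ?m = of_real (- 2 * ?\<rho>)"
    by (simp add: w_def field_simps)
  then have w': "cmod (w - of_real ?m) \<le> 2 * ?\<rho>"
    using ab by (simp only: norm_of_real) simp
  have \<alpha>: "\<bar>\<alpha> - ?m\<bar> < ?\<rho>"
    using ab by (simp add: abs_less_iff field_simps)
  \<comment> \<open>The factor \<open>r i0\<close> costs one power of 2 more than its degree. It
    occurs with multiplicity \<open>i0\<close>, whence the summand \<open>i0\<close> in the exponent
    \<open>i0 + degree R\<close>.\<close>
  define e where "e = (\<lambda>i. degree (r i) + (if i = i0 then 1 else 0))"
  have growth: "cmod (?P i w) \<le> 2 ^ e i * cmod (?P i z)" if "i \<in> ?I" for i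
  proof (cases "i = i0")
    case True
    then show ?thesis
      using Tpred_pderiv_growth(2)[OF T0 root \<alpha> z' w'] by (simp add: e_def)
  next
    case False
    then show ?thesis
      using Tpred_1_growth(2)[OF T[OF that False] _ _ w', of z] z' ab by (simp add: e_def)
  qed
  have "R \<noteq> 0"
    using iso_data_degree_pos[OF iso] by auto
  then have "(\<Prod>i\<in>?I. r i ^ i) \<noteq> 0"
    using R by metis
  then have nz: "r i \<noteq> 0" if "i \<in> ?I" for i
    using that by (auto simp: prod_zero_iff)
  have "degree R = degree (\<Prod>i\<in>?I. r i ^ i)"
    by (rule arg_cong[OF R])
  also have "\<dots> = (\<Sum>i\<in>?I. degree (r i ^ i))"
    by (rule degree_prod_sum_eq) (use nz in auto)
  also have "\<dots> = (\<Sum>i\<in>?I. i * degree (r i))"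
    by (intro sum.cong refl Polynomial.degree_power_eq nz)
  finally have deg: "degree R = (\<Sum>i\<in>?I. i * degree (r i))" .
  have "\<bar>poly (rpoly R) (?m - 2 * ?\<rho>)\<bar> = cmod (poly (map_poly of_int R) w)"
    unfolding w_def of_real_rpoly[symmetric] poly_of_real_of_real norm_of_real ..
  also have "\<dots> = (\<Prod>i\<in>?I. cmod (?P i w) ^ i)"
    unfolding poly_squarefree_product[OF R] prod_norm[symmetric] norm_power ..
  also have "\<dots> \<le> (\<Prod>i\<in>?I. (2 ^ e i * cmod (?P i z)) ^ i)"
    by (intro prod_mono conjI power_mono growth) auto
  also have "\<dots> = (\<Prod>i\<in>?I. 2 ^ (e i * i)) * (\<Prod>i\<in>?I. cmod (?P i z) ^ i)"
    by (simp add: power_mult_distrib power_mult prod.distrib)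
  also have "(\<Prod>i\<in>?I. 2 ^ (e i * i)) = (2 :: real) ^ (\<Sum>i\<in>?I. e i * i)"
    by (simp add: power_sum)
  also have "(\<Sum>i\<in>?I. e i * i) = i0 + degree R"
  proof -
    have "(\<Sum>i\<in>?I. e i * i) = (\<Sum>i\<in>?I. i * degree (r i) + (if i = i0 then i0 else 0))"
      by (intro sum.cong) (auto simp: e_def algebra_simps)
    also have "\<dots> = i0 + degree R"
      using i0 deg by (simp add: sum.distrib)
    finally show ?thesis .
  qed
  also have "(\<Prod>i\<in>?I. cmod (?P i z) ^ i) = cmod (poly (map_poly of_int R) z)"
    unfolding poly_squarefree_product[OF R] prod_norm[symmetric] norm_power ..
  finally show ?thesis
    by (simp add: Lbound_def field_simps)
qed

section \<open>Common zeros in the polydisc\<close>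

text \<open>The minimum principle takes one function on one curve; it controls |F| and |G| at once
  because on a suitable curve both are fixed multiples of the same function.\<close>

lemma common_zero_or_small_on_boundary:
  assumes x0: "x0 \<in> cball m1 r1" and y0: "y0 \<in> cball m2 r2"
  obtains
    (zero) x y where "x \<in> ball m1 r1" "y \<in> ball m2 r2" "bieval F x y = 0" "bieval G x y = 0"
  | (boundary) x y where "x \<in> cball m1 r1" "y \<in> cball m2 r2" "x \<in> sphere m1 r1 \<or> y \<in> sphere m2 r2"
      "cmod (bieval F x y) \<le> cmod (bieval F x0 y0)" "cmod (bieval G x y) \<le> cmod (bieval G x0 y0)"
proof (cases "\<exists>x\<in>cball m1 r1. \<exists>y\<in>cball m2 r2. bieval F x y = 0 \<and> bieval G x y = 0")
  case True
  then obtain x y where xy: "x \<in> cball m1 r1" "y \<in> cball m2 r2" "bieval F x y = 0" "bieval G x y = 0"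
    by blast
  show thesis
  \<comment> \<open>A common zero on the boundary falls under the second alternative, as both moduli
    are 0 there.\<close>
  proof (cases "x \<in> sphere m1 r1 \<or> y \<in> sphere m2 r2")
    case True
    then show thesis
      using boundary[OF xy(1,2)] xy(3,4) by simp
  next
    case False
    then show thesis
      using xy by (intro zero[of x y]) auto
  qed
next
  case False
  define f0 g0 where "f0 = bieval F x0 y0" and "g0 = bieval G x0 y0"
  \<comment> \<open>\<open>N\<close> is the squared Hermitian norm of \<open>(f0, g0)\<close>,
    nonzero because \<open>(x0, y0)\<close> is not a common zero.\<close>
  define N where "N = f0 * cnj f0 + g0 * cnj g0"
  have "N = of_real ((cmod f0)\<^sup>2 + (cmod g0)\<^sup>2)"
    by (simp add: N_def complex_norm_square[symmetric] del: of_real_power)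
  moreover have "(cmod f0)\<^sup>2 + (cmod g0)\<^sup>2 \<noteq> 0"
    using False x0 y0 by (auto simp: f0_def g0_def sum_power2_eq_zero_iff)
  ultimately have N: "N \<noteq> 0"
    by (metis of_real_eq_0_iff)
  \<comment> \<open>On the curve \<open>h = 0\<close>, the vector \<open>(F, G)\<close> is the multiple \<open>k / N\<close> of \<open>(f0, g0)\<close>.\<close>
  define h where "h = Polynomial.smult [:g0:] F - Polynomial.smult [:f0:] G"
  define k where "k = Polynomial.smult [:cnj f0:] F + Polynomial.smult [:cnj g0:] G"
  have proportional: "bieval F x y * N = f0 * bieval k x y" "bieval G x y * N = g0 * bieval k x y"
    if "bieval h x y = 0" for x y
  proof -
    have eq: "g0 * bieval F x y = f0 * bieval G x y"
      using that by (simp add: h_def)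
    have "bieval F x y * N = f0 * (cnj f0 * bieval F x y) + cnj g0 * (g0 * bieval F x y)"
      by (simp add: N_def algebra_simps)
    then show "bieval F x y * N = f0 * bieval k x y"
      unfolding eq by (simp add: k_def algebra_simps)
    have "bieval G x y * N = cnj f0 * (f0 * bieval G x y) + g0 * (cnj g0 * bieval G x y)"
      by (simp add: N_def algebra_simps)
    then show "bieval G x y * N = g0 * bieval k x y"
      unfolding eq[symmetric] by (simp add: k_def algebra_simps)
  qed
  have h0: "bieval h x0 y0 = 0"
    by (simp add: h_def f0_def g0_def)
  have k0: "bieval k x0 y0 = N"
    by (simp add: k_def f0_def g0_def N_def mult.commute)
  \<comment> \<open>A zero of \<open>k\<close> on the curve would be a common zero of
    \<open>F\<close> and \<open>G\<close>, by proportionality.\<close>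
  have "bieval k x y \<noteq> 0" if "x \<in> cball m1 r1" "y \<in> cball m2 r2" "bieval h x y = 0" for x y
    using proportional[OF that(3)] N False that(1,2) by auto
  from curve_minimum_principle[OF x0 y0 h0 this] obtain x y where
    xy: "x \<in> cball m1 r1" "y \<in> cball m2 r2" "x \<in> sphere m1 r1 \<or> y \<in> sphere m2 r2"
      "bieval h x y = 0" "cmod (bieval k x y) \<le> cmod N"
    unfolding k0 by blast
  have "cmod (bieval F x y) * cmod N \<le> cmod f0 * cmod N"
    unfolding norm_mult[symmetric] proportional(1)[OF xy(4)]
    unfolding norm_mult by (rule mult_left_mono[OF xy(5)]) simp
  moreover have "cmod (bieval G x y) * cmod N \<le> cmod g0 * cmod N"
    unfolding norm_mult[symmetric] proportional(2)[OF xy(4)]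
    unfolding norm_mult by (rule mult_left_mono[OF xy(5)]) simp
  ultimately show thesis
    using boundary[OF xy(1-3)] N by (simp add: f0_def g0_def)
qed

section \<open>Application to the two resultants\<close>

lemma eval2_conv_bieval: "eval2 p x y = bieval (map_poly (map_poly of_int) p) x y"
  by (induction p) (simp_all add: Polynomial.map_poly_pCons)

theorem theorem4:
  fixes f g :: "int poly poly"
    and r s :: "nat \<Rightarrow> int poly" and i0 j0 :: nat
    and a b c d \<alpha> \<beta> Uuy Uvy Uux Uvx :: real and x0 y0 :: complex
  assumes nocommon: "\<forall>h. h dvd f \<and> h dvd g \<longrightarrow> degree h = 0 \<and> degree (coeff h 0) = 0"
    and rootA: "poly (rpoly (resultant f g)) \<alpha> = 0"
    and rootB: "poly (rpoly (resultant (swap_xy f) (swap_xy g))) \<beta> = 0"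
    and isoA: "iso_data (resultant f g) r i0 a b \<alpha>"
    and isoB: "iso_data (resultant (swap_xy f) (swap_xy g)) s j0 c d \<beta>"
    and Uuy: "\<forall>z1\<in>cdisc a b. \<forall>z2\<in>cdisc c d. cmod (eval2 (cof_u f g) z1 z2) \<le> Uuy"
    and Uvy: "\<forall>z1\<in>cdisc a b. \<forall>z2\<in>cdisc c d. cmod (eval2 (cof_v f g) z1 z2) \<le> Uvy"
    and Uux: "\<forall>z1\<in>cdisc a b. \<forall>z2\<in>cdisc c d.
                cmod (eval2 (cof_u (swap_xy f) (swap_xy g)) z2 z1) \<le> Uux"
    and Uvx: "\<forall>z1\<in>cdisc a b. \<forall>z2\<in>cdisc c d.
                cmod (eval2 (cof_v (swap_xy f) (swap_xy g)) z2 z1) \<le> Uvx"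
    and x0: "x0 \<in> disc a b" and y0: "y0 \<in> disc c d"
    and ineqA: "Uuy * cmod (eval2 f x0 y0) + Uvy * cmod (eval2 g x0 y0) < Lbound (resultant f g) i0 a b"
    and ineqB: "Uux * cmod (eval2 f x0 y0) + Uvx * cmod (eval2 g x0 y0)
                  < Lbound (resultant (swap_xy f) (swap_xy g)) j0 c d"
  shows "(\<exists>z1\<in>disc a b. \<exists>z2\<in>disc c d. eval2 f z1 z2 = 0 \<and> eval2 g z1 z2 = 0)
         \<and> eval2 f (complex_of_real \<alpha>) (complex_of_real \<beta>) = 0"
proof -
  let ?m1 = "complex_of_real ((a + b) / 2)" and ?r1 = "2 * ((b - a) / 2)"
  let ?m2 = "complex_of_real ((c + d) / 2)" and ?r2 = "2 * ((d - c) / 2)"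
  let ?F = "map_poly (map_poly of_int) f" and ?G = "map_poly (map_poly of_int) g"
  note degA = iso_data_degree_pos[OF isoA] and degB = iso_data_degree_pos[OF isoB]
  have resA: "poly (map_poly of_int (resultant f g)) x =
      eval2 (cof_u f g) x y * eval2 f x y + eval2 (cof_v f g) x y * eval2 g x y" for x y
    by (rule eval2_resultant[OF degA])
  have resB: "poly (map_poly of_int (resultant (swap_xy f) (swap_xy g))) y =
      eval2 (cof_u (swap_xy f) (swap_xy g)) y x * eval2 f x y +
      eval2 (cof_v (swap_xy f) (swap_xy g)) y x * eval2 g x y" for x y
    using eval2_resultant[OF degB, of y x] by (simp add: eval2_swap_xy)
  have x0': "x0 \<in> cball ?m1 ?r1" and y0': "y0 \<in> cball ?m2 ?r2"
    using x0 y0 ball_subset_cball unfolding disc_def by blast+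
  have bound: "cmod (u * v + u' * v') \<le> U * V + U' * V'"
    if "cmod u \<le> U" "cmod u' \<le> U'" "cmod v \<le> V" "cmod v' \<le> V'" for u u' v v' U U' V V'
  proof -
    have "0 \<le> U" "0 \<le> U'"
      using that(1,2) norm_ge_zero order_trans by blast+
    then have "cmod u * cmod v \<le> U * V" "cmod u' * cmod v' \<le> U' * V'"
      using that by (auto intro!: mult_mono)
    then show ?thesis
      using norm_triangle_ineq[of "u * v" "u' * v'"] by (simp add: norm_mult)
  qed
  have "\<exists>z1\<in>disc a b. \<exists>z2\<in>disc c d. eval2 f z1 z2 = 0 \<and> eval2 g z1 z2 = 0"
  proof (rule common_zero_or_small_on_boundary[OF x0' y0', of ?F ?G])
    fix x y
    assume "x \<in> ball ?m1 ?r1" "y \<in> ball ?m2 ?r2" "bieval ?F x y = 0" "bieval ?G x y = 0"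
    then show ?thesis
      unfolding disc_def eval2_conv_bieval by blast
  next
    fix x y
    assume x: "x \<in> cball ?m1 ?r1" and y: "y \<in> cball ?m2 ?r2"
      and on: "x \<in> sphere ?m1 ?r1 \<or> y \<in> sphere ?m2 ?r2"
      and "cmod (bieval ?F x y) \<le> cmod (bieval ?F x0 y0)" "cmod (bieval ?G x y) \<le> cmod (bieval ?G x0 y0)"
    then have small: "cmod (eval2 f x y) \<le> cmod (eval2 f x0 y0)"
      "cmod (eval2 g x y) \<le> cmod (eval2 g x0 y0)"
      by (simp_all add: eval2_conv_bieval)
    have x': "x \<in> cdisc a b" and y': "y \<in> cdisc c d"
      using x y unfolding cdisc_def .
    \<comment> \<open>A point over the circle in x is refuted through the resultant in x, a point
      over the circle in y through the resultant in y.\<close>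
    from on show ?thesis
    proof
      assume "x \<in> sphere ?m1 ?r1"
      then have "Lbound (resultant f g) i0 a b \<le> cmod (poly (map_poly of_int (resultant f g)) x)"
        by (rule Lbound_le_boundary[OF isoA])
      also have "\<dots> \<le> Uuy * cmod (eval2 f x0 y0) + Uvy * cmod (eval2 g x0 y0)"
        unfolding resA[of x y] using Uuy Uvy x' y' small by (intro bound) auto
      finally show ?thesis
        using ineqA by simp
    next
      assume "y \<in> sphere ?m2 ?r2"
      then have "Lbound (resultant (swap_xy f) (swap_xy g)) j0 c d
          \<le> cmod (poly (map_poly of_int (resultant (swap_xy f) (swap_xy g))) y)"
        by (rule Lbound_le_boundary[OF isoB])
      also have "\<dots> \<le> Uux * cmod (eval2 f x0 y0) + Uvx * cmod (eval2 g x0 y0)"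
        unfolding resB[of y x] using Uux Uvx x' y' small by (intro bound) auto
      finally show ?thesis
        using ineqB by simp
    qed
  qed
  then obtain z1 z2 where z: "z1 \<in> disc a b" "z2 \<in> disc c d" "eval2 f z1 z2 = 0" "eval2 g z1 z2 = 0"
    by blast
  have "z1 \<in> cdisc a b" "z2 \<in> cdisc c d"
    using z(1,2) ball_subset_cball unfolding disc_def cdisc_def by blast+
  \<comment> \<open>The cofactor identities turn a common zero into a root of each resultant, and
    these roots are unique in the closed discs.\<close>
  moreover have "poly (map_poly of_int (resultant f g)) z1 = 0"
    using resA[of z1 z2] z by simp
  moreover have "poly (map_poly of_int (resultant (swap_xy f) (swap_xy g))) z2 = 0"
    using resB[of z2 z1] z by simp
  ultimately have "z1 = of_real \<alpha>" "z2 = of_real \<beta>"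
    using iso_data_unique_root[OF isoA] iso_data_unique_root[OF isoB] by blast+
  then show ?thesis
    using z by blast
qed

end
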